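(* Let $B=(V,E)$ be a Bratteli diagram with incidence matrices $F_n=(f^{(n)}_{v,w})$ and stochastic incidence matrices $Q_n=(q^{(n)}_{v,w})$, and let $\overline B$ be a proper vertex subdiagram of $B$ defined by a sequence of subsets $W_n\subset V_n$; put $W'_n=V_n\setminus W_n$. Let $\mu$ be a probability measure on the path space $X_{\overline B}$, invariant with respect to the tail equivalence relation of $\overline B$, and let $\widehat\mu$ be its extension to $\widehat X_{\overline B}$. Then the following are equivalent: (i) $\widehat\mu(\widehat X_{\overline B})<\infty$; (ii) $\displaystyle\sum_{n=1}^{\infty}\ \sum_{w\in W_{n+1}}\widehat\mu(X_w^{(n+1)})\sum_{v\in W'_n}q^{(n)}_{w,v}<\infty$, where for $w\in W_{n+1}$ one has $\widehat\mu(X_w^{(n+1)})=h_w^{(n+1)}p_w^{(n+1)}$ in the sense explained in the context; (iii) $\displaystyle\sum_{i=1}^{\infty}\left(\sum_{w\in W_{i+1}}h_w^{(i+1)}p_w^{(i+1)}-\sum_{w\in W_i}h_w^{(i)}p_w^{(i)}\right)<\infty$.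
   Context: Bratteli diagrams. A Bratteli diagram is an infinite graph $B=(V,E)$ with $V=\bigsqcup_{i\ge 0}V_i$, $E=\bigsqcup_{i\ge1}E_i$, where $V_0=\{v_0\}$ is a single point, all $V_i,E_i$ are finite, and there are a range map $r$ and a source map $s$ from $E$ to $V$ with $r(E_i)=V_i$, $s(E_i)=V_{i-1}$, $s^{-1}(v)\ne\emptyset$ for all $v\in V$ and $r^{-1}(v')\neq\emptyset$ for all $v'\in V\setminus V_0$. Multiple edges are allowed. The $n$-th incidence matrix $F_n=(f^{(n)}_{v,w})$ is the $|V_{n+1}|\times|V_n|$ matrix with $f^{(n)}_{v,w}=|\{e\in E_{n+1}: r(e)=v,\ s(e)=w\}|$, $v\in V_{n+1}$, $w\in V_n$. The path space $X_B$ is the set of infinite paths $x=(x_1,x_2,\dots)$, $x_i\in E_i$, $r(x_i)=s(x_{i+1})$, with the topology generated by cylinder sets of finite paths starting at $v_0$; it is assumed that $X_B$ is a Cantor set. Two paths $x=(x_n),y=(y_n)$ are tail equivalent (relation $\mathcal E$) if $x_n=y_n$ for all sufficiently large $n$. A Borel measure is $\mathcal E$-invariant if, for any two finite paths $s,s'$ from $v_0$ to the same vertex, the map replacing the initial segment $s$ by $s'$ preserves the measure. Heights and stochastic matrices. For $v\in V_n$, $h_v^{(n)}$ is the number of finite paths in $B$ from $v_0$ to $v$, and $X_v^{(n)}$ denotes the set of infinite paths passing through $v$. The stochastic incidence matrices $Q_n$ have entries $q^{(n)}_{v,w}=f^{(n)}_{v,w}\,h_w^{(n)}/h_v^{(n+1)}$,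 $v\in V_{n+1}$, $w\in V_n$. Subdiagrams. Let $W_0=V_0$ and, for $n>0$, let $W_n$ be a proper non-empty subset of $V_n$. The vertex subdiagram $\overline B=(\overline W,\overline E)$ has vertices $\overline W=\bigcup_n W_n$ and edges all $e\in E$ with both source and range in $\overline W$; it is assumed to be itself a Bratteli diagram. $X_{\overline B}\subset X_B$ is the set of infinite paths all of whose edges belong to $\overline B$, and $\widehat X_{\overline B}$ is the set of all paths in $X_B$ tail equivalent to some path in $X_{\overline B}$. Measure extension. Given a probability measure $\mu$ on $X_{\overline B}$ invariant under the tail equivalence relation of $\overline B$, $\widehat\mu$ is the unique $\mathcal E$-invariant Borel measure on $\widehat X_{\overline B}$ whose restriction to $X_{\overline B}$ is $\mu$; it may be finite or infinite. For $w\in W_n$, $p_w^{(n)}=\mu([\overline e])$, where $\overline e$ is any finite path of $\overline B$ from $v_0$ to $w$ and $[\overline e]\subset X_{\overline B}$ is its cylinder set in $X_{\overline B}$ (independent of $\overline e$ by invariance). For any finite path $s$ of $B$ from $v_0$ to $w\in W_n$ one sets $\widehat\mu([s])=\mu([\overline e])=p_w^{(n)}$, so that $\widehat\mu(X_w^{(n)})=h_w^{(n)}p_w^{(n)}$ for $w\in W_n$; here, accordingly, this quantity is the $\widehat\mu$-measure of $\{x=(x_i)\in\widehat X_{\overline B}: r(x_n)=w,\ r(x_i)\in W_i\ \text{for all } i\ge n\}$. *)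

theory Defs
  imports "HOL-Probability.Probability_Measure"
begin

section \<open>Bratteli diagrams\<close>

text \<open>
  The edge set \<^term>\<open>edges B n\<close> is the set usually called \<open>E\<^sub>n\<close>; it is meaningful only for
  \<open>n \<ge> 1\<close>, and \<^term>\<open>edges B 0\<close> is never consulted.
\<close>

record ('v, 'e) diagram =
  verts :: "nat \<Rightarrow> 'v set"
  edges :: "nat \<Rightarrow> 'e set"
  src :: "'e \<Rightarrow> 'v"
  rng :: "'e \<Rightarrow> 'v"

locale bratteli_diagram =
  fixes B :: "('v, 'e) diagram"
  assumes root: "\<exists>v0. verts B 0 = {v0}"
    and finite_verts: "\<And>n. finite (verts B n)"
    and finite_edges: "\<And>n. finite (edges B (Suc n))"
    and disjoint_verts: "\<And>m n. m \<noteq> n \<Longrightarrow> verts B m \<inter> verts B n = {}"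
    and disjoint_edges: "\<And>m n. m \<noteq> n \<Longrightarrow> edges B (Suc m) \<inter> edges B (Suc n) = {}"
    and rng_edges: "\<And>n. rng B ` edges B (Suc n) = verts B (Suc n)"
    and src_edges: "\<And>n. src B ` edges B (Suc n) = verts B n"
    and out_edge: "\<And>n v. v \<in> verts B n \<Longrightarrow> \<exists>m. \<exists>e\<in>edges B (Suc m). src B e = v"
    and in_edge: "\<And>n v. v \<in> verts B (Suc n) \<Longrightarrow> \<exists>m. \<exists>e\<in>edges B (Suc m). rng B e = v"

definition incidence :: "('v, 'e) diagram \<Rightarrow> nat \<Rightarrow> 'v \<Rightarrow> 'v \<Rightarrow> nat" where
  "incidence B n v w = card {e \<in> edges B (Suc n). rng B e = v \<and> src B e = w}"

section \<open>Path spaces\<close>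

text \<open>
  Paths are indexed from \<open>0\<close>: the entry \<open>x k\<close> of an infinite path, like the entry \<open>e ! k\<close> of a
  finite one, is its \<open>(k + 1)\<close>-st edge.
\<close>

definition path_space :: "('v, 'e) diagram \<Rightarrow> (nat \<Rightarrow> 'e) set" where
  "path_space B =
     {x. \<forall>k. x k \<in> edges B (Suc k) \<and> rng B (x k) = src B (x (Suc k))}"

definition finite_paths :: "('v, 'e) diagram \<Rightarrow> nat \<Rightarrow> 'e list set" where
  "finite_paths B n =
     {e. length e = n \<and> (\<forall>k<n. e ! k \<in> edges B (Suc k)) \<and>
         (\<forall>k. Suc k < n \<longrightarrow> rng B (e ! k) = src B (e ! Suc k))}"

text \<open>
  The finite paths from the root to the vertex \<open>v\<close> of level \<open>n\<close>; the only path of length \<open>0\<close> is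
  the empty one, which ends at the root.
\<close>

definition paths_to :: "('v, 'e) diagram \<Rightarrow> nat \<Rightarrow> 'v \<Rightarrow> 'e list set" where
  "paths_to B n v =
     {e \<in> finite_paths B n. if n = 0 then v \<in> verts B 0 else rng B (last e) = v}"

definition cylinder :: "('v, 'e) diagram \<Rightarrow> 'e list \<Rightarrow> (nat \<Rightarrow> 'e) set" where
  "cylinder B e = {x \<in> path_space B. \<forall>k<length e. x k = e ! k}"

definition path_topology :: "('v, 'e) diagram \<Rightarrow> (nat \<Rightarrow> 'e) topology" where
  "path_topology B = topology_generated_by {cylinder B e | e n. e \<in> finite_paths B n}"

definition cantor_topology :: "(nat \<Rightarrow> bool) topology" where
  "cantor_topology = product_topology (\<lambda>_. discrete_topology UNIV) UNIV"

definition is_cantor_set :: "'a topology \<Rightarrow> bool" where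
  "is_cantor_set T \<longleftrightarrow> T homeomorphic_space cantor_topology"

definition tail_equivalent :: "(nat \<Rightarrow> 'e) \<Rightarrow> (nat \<Rightarrow> 'e) \<Rightarrow> bool" where
  "tail_equivalent x y \<longleftrightarrow> (\<exists>N. \<forall>n\<ge>N. x n = y n)"

section \<open>Heights and stochastic matrices\<close>

definition height :: "('v, 'e) diagram \<Rightarrow> nat \<Rightarrow> 'v \<Rightarrow> nat" where
  "height B n v = card (paths_to B n v)"

definition stoch :: "('v, 'e) diagram \<Rightarrow> nat \<Rightarrow> 'v \<Rightarrow> 'v \<Rightarrow> real" where
  "stoch B n v w =
     real (incidence B n v w) * real (height B n w) / real (height B (Suc n) v)"

section \<open>Invariant measures\<close>

definition borel_of :: "'a topology \<Rightarrow> 'a measure" where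
  "borel_of T = sigma (topspace T) {U. openin T U}"

definition replace_initial :: "'e list \<Rightarrow> (nat \<Rightarrow> 'e) \<Rightarrow> (nat \<Rightarrow> 'e)" where
  "replace_initial s x = (\<lambda>k. if k < length s then s ! k else x k)"

text \<open>
  The space of \<open>M\<close> may be any tail-invariant Borel subset of the path space. On paths starting with
  \<open>s\<close>, the map \<^term>\<open>replace_initial s'\<close> replaces \<open>s\<close> by \<open>s'\<close>, as both have length \<open>n\<close>.
\<close>

definition tail_invariant :: "('v, 'e) diagram \<Rightarrow> (nat \<Rightarrow> 'e) measure \<Rightarrow> bool" where
  "tail_invariant B M \<longleftrightarrow>
     (\<forall>n. \<forall>v\<in>verts B n. \<forall>s\<in>paths_to B n v. \<forall>s'\<in>paths_to B n v.
        \<forall>A\<in>sets M. A \<subseteq> cylinder B s \<longrightarrow>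
          replace_initial s' ` A \<in> sets M \<and> emeasure M (replace_initial s' ` A) = emeasure M A)"

text \<open>
  The common measure of the cylinders given by the paths from the root to \<open>w\<close>; for an invariant
  \<open>M\<close> it does not depend on the path chosen.
\<close>

definition cylinder_weight :: "('v, 'e) diagram \<Rightarrow> (nat \<Rightarrow> 'e) measure \<Rightarrow> nat \<Rightarrow> 'v \<Rightarrow> real" where
  "cylinder_weight B M n w = measure M (cylinder B (SOME e. e \<in> paths_to B n w))"

section \<open>Vertex subdiagrams and extension of measures\<close>

definition vertex_subdiagram ::
    "('v, 'e) diagram \<Rightarrow> (nat \<Rightarrow> 'v set) \<Rightarrow> ('v, 'e) diagram" where
  "vertex_subdiagram B W =
     B\<lparr>verts := W,
       edges := \<lambda>n. {e \<in> edges B n. src B e \<in> (\<Union>i. W i) \<and> rng B e \<in> (\<Union>i. W i)}\<rparr>"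

definition proper_vertex_subdiagram ::
    "('v, 'e) diagram \<Rightarrow> (nat \<Rightarrow> 'v set) \<Rightarrow> bool" where
  "proper_vertex_subdiagram B W \<longleftrightarrow>
     W 0 = verts B 0 \<and> (\<forall>n>0. W n \<noteq> {} \<and> W n \<subset> verts B n) \<and>
     bratteli_diagram (vertex_subdiagram B W)"

definition saturation :: "('v, 'e) diagram \<Rightarrow> (nat \<Rightarrow> 'v set) \<Rightarrow> (nat \<Rightarrow> 'e) set" where
  "saturation B W =
     {x \<in> path_space B. \<exists>y\<in>path_space (vertex_subdiagram B W). tail_equivalent x y}"

definition is_extension ::
    "('v, 'e) diagram \<Rightarrow> (nat \<Rightarrow> 'v set) \<Rightarrow> (nat \<Rightarrow> 'e) measure \<Rightarrow> (nat \<Rightarrow> 'e) measure \<Rightarrow> bool" where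
  "is_extension B W \<mu> \<mu>' \<longleftrightarrow>
     sets \<mu>' = sets (borel_of (subtopology (path_topology B) (saturation B W))) \<and>
     tail_invariant B \<mu>' \<and>
     restrict_space \<mu>' (path_space (vertex_subdiagram B W)) = \<mu>"

text \<open>
  The paths that pass through \<open>w\<close> at level \<open>n \<ge> 1\<close> and stay in the subdiagram from there on;
  \<open>x (i - 1)\<close> is the \<open>i\<close>-th edge of \<open>x\<close>.
\<close>

definition tower_part ::
    "('v, 'e) diagram \<Rightarrow> (nat \<Rightarrow> 'v set) \<Rightarrow> nat \<Rightarrow> 'v \<Rightarrow> (nat \<Rightarrow> 'e) set" where
  "tower_part B W n w =
     {x \<in> saturation B W. rng B (x (n - 1)) = w \<and> (\<forall>i\<ge>n. rng B (x (i - 1)) \<in> W i)}"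

end

theory Submission
  imports Defs
begin

text \<open>
  Let \<open>T\<^sub>n\<close> be the set of all paths of \<open>B\<close> that visit only vertices of the subdiagram from level \<open>n\<close>
  on. A path is tail equivalent to a path of the subdiagram exactly if it lies in some \<open>T\<^sub>n\<close>, so the
  \<open>T\<^sub>n\<close> increase to the saturation, and everything reduces to the masses \<open>m\<^sub>n = \<mu>'(T\<^sub>n)\<close>.

  The set \<open>T\<^sub>n\<close> splits into disjoint pieces according to the initial segment \<open>s\<close> of length \<open>n\<close>. If
  \<open>s\<close> ends at \<open>w\<close>, then its piece arises from a cylinder of the subdiagram by replacing an initial
  segment, so invariance gives it the measure \<open>p\<^sub>w\<close>. Hence every set of initial segments ending
  at \<open>w\<close> contributes its cardinality times \<open>p\<^sub>w\<close>.
   \<^item> Counting all segments gives \<open>m\<^sub>n = (\<Sum>w\<in>W\<^sub>n. h\<^sub>w p\<^sub>w)\<close>, a finite number.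
   \<^item> A path of \<open>T\<^bsub>n+1\<^esub>\<close> is not in \<open>T\<^sub>n\<close> exactly if its vertex \<open>v\<close> at level \<open>n\<close> is outside \<open>W\<^sub>n\<close>.
     There are \<open>f\<^bsub>wv\<^esub> h\<^sub>v = h\<^sub>w q\<^bsub>wv\<^esub>\<close> segments to \<open>w\<close> through \<open>v\<close>, so
     \<open>m\<^bsub>n+1\<^esub> - m\<^sub>n = (\<Sum>w. h\<^sub>w p\<^sub>w * (\<Sum>v\<notin>W\<^sub>n. q\<^bsub>wv\<^esub>))\<close>.

  So both series are the series of the nonnegative increments of the masses, and the saturation
  has measure \<open>m\<^sub>1\<close> plus the sum of that series; all three conditions say that it converges.
  The carrying lemmas are \<open>branch_eq_image\<close>, \<open>emeasure_branches\<close>, \<open>mass_increment\<close> and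
  \<open>emeasure_saturation\<close>.
\<close>

section \<open>Finite paths\<close>

lemma (in bratteli_diagram) edge_ends:
  assumes "e \<in> edges B (Suc n)"
  shows "src B e \<in> verts B n" and "rng B e \<in> verts B (Suc n)"
  using assms rng_edges[of n] src_edges[of n] by auto

lemma paths_to_Suc_iff:
  "s \<in> paths_to D (Suc n) w \<longleftrightarrow> s \<in> finite_paths D (Suc n) \<and> rng D (s ! n) = w"
proof -
  have "last s = s ! n" if "length s = Suc n"
    using that by (subst last_conv_nth) auto
  then show ?thesis
    by (auto simp: paths_to_def finite_paths_def)
qed

lemma finite_paths_snoc:
  assumes "s \<in> finite_paths D n" and "e \<in> edges D (Suc n)"
    and "\<And>m. n = Suc m \<Longrightarrow> rng D (s ! m) = src D e"
  shows "s @ [e] \<in> finite_paths D (Suc n)"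
  using assms by (auto simp: finite_paths_def nth_append less_Suc_eq)

lemma finite_paths_take:
  "s \<in> finite_paths D (Suc n) \<Longrightarrow> take n s \<in> finite_paths D n"
  by (auto simp: finite_paths_def)

lemma finite_path_of_infinite:
  "x \<in> path_space D \<Longrightarrow> map x [0..<n] \<in> finite_paths D n"
  by (auto simp: finite_paths_def path_space_def)

lemma (in bratteli_diagram) finite_finite_paths: "finite (finite_paths B n)"
proof (rule finite_subset)
  show "finite_paths B n \<subseteq> {s. set s \<subseteq> (\<Union>k<n. edges B (Suc k)) \<and> length s = n}"
  proof (clarsimp simp: finite_paths_def in_set_conv_nth)
    fix s :: "'e list" and k
    assume "\<forall>k<length s. s ! k \<in> edges B (Suc k)" "k < length s"
    then show "\<exists>j\<in>{..<length s}. s ! k \<in> edges B (Suc j)"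
      by (intro bexI[of _ k]) auto
  qed
  show "finite {s. set s \<subseteq> (\<Union>k<n. edges B (Suc k)) \<and> length s = n}"
    by (intro finite_lists_length_eq) (auto intro: finite_edges)
qed

lemma (in bratteli_diagram) finite_paths_to: "finite (paths_to B n v)"
  by (rule finite_subset[OF _ finite_finite_paths[of n]]) (auto simp: paths_to_def)

lemma (in bratteli_diagram) paths_to_nonempty:
  assumes "v \<in> verts B n"
  shows "paths_to B n v \<noteq> {}"
  using assms
proof (induction n arbitrary: v)
  case 0
  then show ?case by (auto simp: paths_to_def finite_paths_def)
next
  case (Suc n)
  then obtain e where e: "e \<in> edges B (Suc n)" "rng B e = v"
    using rng_edges[of n] by (metis imageE)
  then obtain s where s: "s \<in> paths_to B n (src B e)"
    using Suc.IH edge_ends(1) by blast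
  have "s @ [e] \<in> finite_paths B (Suc n)"
  proof (rule finite_paths_snoc)
    show "s \<in> finite_paths B n" using s by (simp add: paths_to_def)
    show "rng B (s ! m) = src B e" if "n = Suc m" for m
      using s that by (simp add: paths_to_Suc_iff)
  qed (rule e)
  then have "s @ [e] \<in> paths_to B (Suc n) v"
    using e s by (simp add: paths_to_Suc_iff) (simp add: paths_to_def finite_paths_def nth_append)
  then show ?case by blast
qed

lemma (in bratteli_diagram) height_pos: "v \<in> verts B n \<Longrightarrow> height B n v > 0"
  using paths_to_nonempty finite_paths_to by (simp add: height_def card_gt_0_iff)

text \<open>
  A path to \<open>w\<close> through \<open>v\<close> is a path to \<open>v\<close> followed by one of the edges from \<open>v\<close> to \<open>w\<close>. The
  vertex \<open>v\<close> is at level \<open>n + 1\<close>, as only vertices past the root are ranges of edges.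
\<close>

lemma (in bratteli_diagram) card_paths_through:
  "card {s \<in> paths_to B (Suc (Suc n)) w. rng B (s ! n) = v} =
     incidence B (Suc n) w v * height B (Suc n) v"
proof -
  let ?E = "{e \<in> edges B (Suc (Suc n)). rng B e = w \<and> src B e = v}"
  let ?P = "paths_to B (Suc n) v"
  let ?S = "{s \<in> paths_to B (Suc (Suc n)) w. rng B (s ! n) = v}"
  have "bij_betw (\<lambda>(e, s). s @ [e]) (?E \<times> ?P) ?S"
  proof (rule bij_betw_byWitness[where f' = "\<lambda>s. (s ! Suc n, take (Suc n) s)"])
    show "\<forall>a\<in>?E \<times> ?P. (\<lambda>s. (s ! Suc n, take (Suc n) s)) ((\<lambda>(e, s). s @ [e]) a) = a"
      by (auto simp: paths_to_def finite_paths_def nth_append)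
    show "\<forall>s\<in>?S. (\<lambda>(e, s). s @ [e]) (s ! Suc n, take (Suc n) s) = s"
      by (auto simp: paths_to_def finite_paths_def take_Suc_conv_app_nth[symmetric])
    show "(\<lambda>(e, s). s @ [e]) ` (?E \<times> ?P) \<subseteq> ?S"
    proof clarsimp
      fix e s
      assume a: "e \<in> edges B (Suc (Suc n))" "s \<in> paths_to B (Suc n) (src B e)"
      then have "length s = Suc n" "s @ [e] \<in> finite_paths B (Suc (Suc n))"
        by (auto intro!: finite_paths_snoc simp: paths_to_Suc_iff) (auto simp: finite_paths_def)
      with a show "s @ [e] \<in> paths_to B (Suc (Suc n)) (rng B e) \<and>
          rng B ((s @ [e]) ! n) = src B e"
        by (auto simp: paths_to_Suc_iff nth_append)
    qed
    show "(\<lambda>s. (s ! Suc n, take (Suc n) s)) ` ?S \<subseteq> ?E \<times> ?P"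
      using finite_paths_take[of _ B "Suc n"]
      by (auto simp: paths_to_Suc_iff) (auto simp: finite_paths_def)
  qed
  then have "card ?S = card (?E \<times> ?P)"
    by (simp add: bij_betw_same_card)
  then show ?thesis
    by (simp add: card_cartesian_product incidence_def height_def)
qed

section \<open>The path topology\<close>

lemma openin_cylinder:
  "s \<in> finite_paths D n \<Longrightarrow> openin (path_topology D) (cylinder D s)"
  unfolding path_topology_def by (rule topology_generated_by_Basis) blast

lemma topspace_path_topology: "topspace (path_topology D) = path_space D"
proof -
  have "[] \<in> finite_paths D 0" "cylinder D [] = path_space D"
    by (auto simp: finite_paths_def cylinder_def)
  then have "path_space D \<in> {cylinder D e |e n. e \<in> finite_paths D n}"
    by blast
  then show ?thesis
    unfolding path_topology_def topology_generated_by_topspace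
    by (auto simp: cylinder_def)
qed

text \<open>
  An edge is determined by the finite path up to it, so a condition on one edge is a union of
  cylinders. Such conditions cut the path space of the subdiagram out of the whole path space.
\<close>

lemma openin_edge_constraint:
  "openin (path_topology D) {x \<in> path_space D. x k \<in> F}"
proof -
  have "{x \<in> path_space D. x k \<in> F} =
      (\<Union>s\<in>{s \<in> finite_paths D (Suc k). s ! k \<in> F}. cylinder D s)" (is "_ = ?U")
  proof
    show "{x \<in> path_space D. x k \<in> F} \<subseteq> ?U"
    proof clarify
      fix x assume x: "x \<in> path_space D" "x k \<in> F"
      let ?s = "map x [0..<Suc k]"
      have "?s \<in> finite_paths D (Suc k)" "?s ! k \<in> F" "x \<in> cylinder D ?s"
        using finite_path_of_infinite[OF x(1), of "Suc k"] x
        by (auto simp: cylinder_def nth_append less_Suc_eq)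
      then show "x \<in> ?U" by blast
    qed
  qed (auto simp: cylinder_def finite_paths_def)
  also have "openin (path_topology D) \<dots>"
    by (rule openin_Union) (auto intro: openin_cylinder)
  finally show ?thesis .
qed

lemma sets_borel_of: "sets (borel_of T) = sigma_sets (topspace T) {U. openin T U}"
  unfolding borel_of_def by (intro sets_measure_of) (auto dest: openin_subset)

section \<open>Vertex subdiagrams\<close>

lemma vertex_subdiagram_simps [simp]:
  "verts (vertex_subdiagram B W) = W"
  "edges (vertex_subdiagram B W) n =
     {e \<in> edges B n. src B e \<in> (\<Union>i. W i) \<and> rng B e \<in> (\<Union>i. W i)}"
  "src (vertex_subdiagram B W) = src B"
  "rng (vertex_subdiagram B W) = rng B"
  by (simp_all add: vertex_subdiagram_def)

lemma path_space_subdiagram: "path_space (vertex_subdiagram B W) \<subseteq> path_space B"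
  by (auto simp: path_space_def)

lemma paths_to_subdiagram:
  "W 0 \<subseteq> verts B 0 \<Longrightarrow> paths_to (vertex_subdiagram B W) n w \<subseteq> paths_to B n w"
  by (auto simp: paths_to_def finite_paths_def)

locale measure_extension = bratteli_diagram B for B :: "('v, 'e) diagram" +
  fixes W :: "nat \<Rightarrow> 'v set" and \<mu> \<mu>' :: "(nat \<Rightarrow> 'e) measure"
  assumes proper: "proper_vertex_subdiagram B W"
    and sets_mu: "sets \<mu> = sets (borel_of (path_topology (vertex_subdiagram B W)))"
    and prob: "prob_space \<mu>"
    and ext: "is_extension B W \<mu> \<mu>'"
begin

abbreviation "C \<equiv> vertex_subdiagram B W"

definition weight :: "nat \<Rightarrow> 'v \<Rightarrow> real" where
  "weight n w = cylinder_weight C \<mu> n w"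

text \<open>
  The sets \<open>T\<^sub>n\<close> of the introduction. The edge \<open>x (i - 1)\<close> ends at level \<open>i\<close>; only \<open>n \<ge> 1\<close> has this
  meaning, since truncated subtraction identifies levels \<open>0\<close> and \<open>1\<close>.
\<close>

definition confined :: "nat \<Rightarrow> (nat \<Rightarrow> 'e) set" where
  "confined n = {x \<in> saturation B W. \<forall>i\<ge>n. rng B (x (i - 1)) \<in> W i}"

definition branch :: "nat \<Rightarrow> 'e list \<Rightarrow> (nat \<Rightarrow> 'e) set" where
  "branch n s = {x \<in> confined n. \<forall>k<n. x k = s ! k}"

sublocale C: bratteli_diagram C
  using proper by (simp add: proper_vertex_subdiagram_def)

lemma W_subset: "W n \<subseteq> verts B n"
  using proper by (cases "n = 0") (auto simp: proper_vertex_subdiagram_def)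

lemma finite_W: "finite (W n)"
  using finite_subset[OF W_subset finite_verts] .

text \<open>
  The edges of a vertex subdiagram are defined by their ends lying at any level of \<open>W\<close>. That they
  join consecutive levels comes from the subdiagram being a Bratteli diagram itself.
\<close>

lemma subdiagram_edge_iff:
  "e \<in> edges C (Suc k) \<longleftrightarrow> e \<in> edges B (Suc k) \<and> src B e \<in> W k \<and> rng B e \<in> W (Suc k)"
  using C.edge_ends[of e k] by auto

lemma saturation_subset: "saturation B W \<subseteq> path_space B"
  by (auto simp: saturation_def)

lemma sets_ext:
  "sets \<mu>' = sigma_sets (saturation B W) {U. openin (subtopology (path_topology B) (saturation B W)) U}"
  using ext saturation_subset
  by (simp add: is_extension_def sets_borel_of topspace_path_topology Int_absorb1)

lemma space_ext: "space \<mu>' = saturation B W"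
proof -
  have "{U. openin (subtopology (path_topology B) (saturation B W)) U} \<subseteq> Pow (saturation B W)"
    using saturation_subset by (auto dest!: openin_subset)
  then have "sets \<mu>' = sets (sigma (saturation B W)
      {U. openin (subtopology (path_topology B) (saturation B W)) U})"
    by (simp add: sets_ext)
  then show ?thesis
    by (drule_tac sets_eq_imp_space_eq) (simp add: space_measure_of_conv)
qed

lemma subdiagram_paths_subset_saturation: "path_space C \<subseteq> saturation B W"
  using path_space_subdiagram by (fastforce simp: saturation_def tail_equivalent_def)

text \<open>
  The restriction of \<open>\<mu>'\<close> to the paths of the subdiagram takes the values of \<open>\<mu>'\<close> only because these
  paths form a measurable set. They are given by a countable family of conditions on single edges.
\<close>

lemma subdiagram_paths_measurable: "path_space C \<in> sets \<mu>'"
proof -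
  let ?S = "\<lambda>k. {x \<in> path_space B. x k \<in> edges C (Suc k)} \<inter> saturation B W"
  have "?S k \<in> sets \<mu>'" for k
    unfolding sets_ext
    by (intro sigma_sets.Basic CollectI openin_subtopology_Int openin_edge_constraint)
  then have "(\<Inter>k. ?S k) \<in> sets \<mu>'"
    by (intro sets.countable_INT) auto
  also have "(\<Inter>k. ?S k) = path_space C"
  proof
    show "path_space C \<subseteq> (\<Inter>k. ?S k)"
      using subdiagram_paths_subset_saturation path_space_subdiagram by (fastforce simp: path_space_def)
  qed (auto simp: path_space_def)
  finally show ?thesis .
qed

lemma subdiagram_cylinder:
  assumes "e \<in> finite_paths C n"
  shows "cylinder C e \<in> sets \<mu>'"
    and "emeasure \<mu>' (cylinder C e) = emeasure \<mu> (cylinder C e)"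
proof -
  have \<mu>: "restrict_space \<mu>' (path_space C) = \<mu>"
    using ext by (simp add: is_extension_def)
  have P: "path_space C \<inter> space \<mu>' \<in> sets \<mu>'"
    using subdiagram_paths_measurable by auto
  have "cylinder C e \<in> sets \<mu>"
    unfolding sets_mu sets_borel_of using openin_cylinder[OF assms] by blast
  then show "cylinder C e \<in> sets \<mu>'"
    using sets_restrict_space_iff[OF P] \<mu> by auto
  have "cylinder C e \<subseteq> path_space C"
    by (auto simp: cylinder_def)
  from emeasure_restrict_space[OF P this]
  show "emeasure \<mu>' (cylinder C e) = emeasure \<mu> (cylinder C e)"
    by (simp add: \<mu>)
qed

text \<open>
  Past level \<open>n + 1\<close> a confined path uses edges of the subdiagram only, so exchanging its initial
  segment \<open>s\<close> for the path \<open>e\<close> of the subdiagram, which ends at the same vertex, turns it into a path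
  of the subdiagram. The exchange in the other direction undoes this.
\<close>

lemma branch_eq_image:
  assumes w: "w \<in> W (Suc n)" and s: "s \<in> paths_to B (Suc n) w"
    and e: "e \<in> paths_to C (Suc n) w"
  shows "branch (Suc n) s = replace_initial s ` cylinder C e"
proof
  have s': "length s = Suc n" "\<And>k. k \<le> n \<Longrightarrow> s ! k \<in> edges B (Suc k)"
    "\<And>k. k < n \<Longrightarrow> rng B (s ! k) = src B (s ! Suc k)" "rng B (s ! n) = w"
    using s by (auto simp: paths_to_Suc_iff finite_paths_def)
  have e': "length e = Suc n" "\<And>k. k \<le> n \<Longrightarrow> e ! k \<in> edges C (Suc k)"
    "\<And>k. k < n \<Longrightarrow> rng B (e ! k) = src B (e ! Suc k)" "rng B (e ! n) = w"
    using e by (auto simp: paths_to_Suc_iff finite_paths_def)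
  show "replace_initial s ` cylinder C e \<subseteq> branch (Suc n) s"
  proof clarify
    fix y assume "y \<in> cylinder C e"
    then have y: "y \<in> path_space C" and ye: "\<And>k. k \<le> n \<Longrightarrow> y k = e ! k"
      using e'(1) by (auto simp: cylinder_def)
    have yk: "y k \<in> edges C (Suc k)" "rng B (y k) = src B (y (Suc k))" for k
      using y by (auto simp: path_space_def)
    let ?x = "replace_initial s y"
    have x: "?x k = (if k \<le> n then s ! k else y k)" for k
      using s'(1) by (auto simp: replace_initial_def)
    have "?x \<in> path_space B"
      unfolding path_space_def
    proof (intro CollectI allI conjI)
      fix k
      show "?x k \<in> edges B (Suc k)"
        using yk(1)[of k] s'(2)[of k] by (auto simp: x)
      consider "k < n" | "k = n" | "k > n" by linarith
      then show "rng B (?x k) = src B (?x (Suc k))"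
      proof cases
        case 1
        then show ?thesis using s'(3)[of k] by (simp add: x)
      next
        case 2
        then show ?thesis using s'(4) e'(4) ye[of n] yk(2)[of n] by (simp add: x)
      next
        case 3
        then show ?thesis using yk(2)[of k] by (simp add: x)
      qed
    qed
    moreover have "tail_equivalent ?x y"
      unfolding tail_equivalent_def by (rule exI[of _ "Suc n"]) (simp add: x)
    ultimately have sat: "?x \<in> saturation B W"
      using y by (auto simp: saturation_def)
    have "rng B (?x (i - 1)) \<in> W i" if "i \<ge> Suc n" for i
    proof (cases "i = Suc n")
      case True
      then show ?thesis using w s'(4) by (simp add: x)
    next
      case False
      with that obtain j where j: "i = Suc j" "j > n"
        by (cases i) auto
      have "rng B (y j) \<in> W (Suc j)"
        using yk(1)[of j] by (simp only: subdiagram_edge_iff)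
      with j show ?thesis by (simp add: x)
    qed
    with sat show "?x \<in> branch (Suc n) s"
      by (auto simp: branch_def confined_def x)
  qed
  show "branch (Suc n) s \<subseteq> replace_initial s ` cylinder C e"
  proof
    fix x assume "x \<in> branch (Suc n) s"
    then have xB: "x \<in> path_space B" and xs: "\<And>k. k \<le> n \<Longrightarrow> x k = s ! k"
      and xW: "\<And>j. j \<ge> n \<Longrightarrow> rng B (x j) \<in> W (Suc j)"
      using saturation_subset by (fastforce simp: branch_def confined_def)+
    have xk: "x k \<in> edges B (Suc k)" "rng B (x k) = src B (x (Suc k))" for k
      using xB by (auto simp: path_space_def)
    let ?y = "replace_initial e x"
    have y: "?y k = (if k \<le> n then e ! k else x k)" for k
      using e'(1) by (auto simp: replace_initial_def)
    have "?y \<in> path_space C"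
      unfolding path_space_def
    proof (intro CollectI allI conjI)
      fix k
      show "?y k \<in> edges C (Suc k)"
      proof (cases "k \<le> n")
        case True
        then show ?thesis using e'(2)[of k] by (simp add: y del: vertex_subdiagram_simps(2))
      next
        case False
        then obtain j where "k = Suc j" "j \<ge> n"
          by (cases k) auto
        then have "x k \<in> edges C (Suc k)"
          using xk[of k] xk(2)[of j] xW[of j] xW[of k]
          by (simp add: subdiagram_edge_iff del: vertex_subdiagram_simps(2))
        with False show ?thesis by (simp add: y del: vertex_subdiagram_simps(2))
      qed
      consider "k < n" | "k = n" | "k > n" by linarith
      then show "rng C (?y k) = src C (?y (Suc k))"
      proof cases
        case 1
        then show ?thesis using e'(3)[of k] by (simp add: y)
      next
        case 2
        then show ?thesis using e'(4) s'(4) xs[of n] xk(2)[of n] by (simp add: y)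
      next
        case 3
        then show ?thesis using xk(2)[of k] by (simp add: y)
      qed
    qed
    then have "?y \<in> cylinder C e"
      using e'(1) by (auto simp: cylinder_def y)
    moreover have "replace_initial s ?y = x"
      using s'(1) e'(1) xs by (auto simp: replace_initial_def fun_eq_iff)
    ultimately show "x \<in> replace_initial s ` cylinder C e"
      by (metis imageI)
  qed
qed

text \<open>
  The extension only knows \<open>\<mu>\<close> on paths of the subdiagram; invariance carries its values over to
  initial segments that leave the subdiagram.
\<close>

lemma emeasure_branch:
  assumes w: "w \<in> W (Suc n)" and s: "s \<in> paths_to B (Suc n) w"
  shows "branch (Suc n) s \<in> sets \<mu>'"
    and "emeasure \<mu>' (branch (Suc n) s) = ennreal (weight (Suc n) w)"
proof -
  \<comment> \<open>The same choice of path as in the definition of the cylinder weight.\<close>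
  define e where "e = (SOME e. e \<in> paths_to C (Suc n) w)"
  have e: "e \<in> paths_to C (Suc n) w"
    unfolding e_def using C.paths_to_nonempty[of w "Suc n"] w by (simp add: some_in_eq)
  then have eB: "e \<in> paths_to B (Suc n) w"
    using paths_to_subdiagram[of W B] W_subset by blast
  have fin: "e \<in> finite_paths C (Suc n)"
    using e by (simp add: paths_to_def)
  have sub: "cylinder C e \<subseteq> cylinder B e"
    using path_space_subdiagram by (fastforce simp: cylinder_def)
  have "tail_invariant B \<mu>'"
    using ext by (simp add: is_extension_def)
  then have *: "replace_initial s ` cylinder C e \<in> sets \<mu>' \<and>
      emeasure \<mu>' (replace_initial s ` cylinder C e) = emeasure \<mu>' (cylinder C e)"
    using w W_subset eB s sub subdiagram_cylinder(1)[OF fin] unfolding tail_invariant_def by blast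
  interpret prob_space \<mu> by (rule prob)
  have "emeasure \<mu>' (cylinder C e) = ennreal (weight (Suc n) w)"
    unfolding subdiagram_cylinder(2)[OF fin] emeasure_eq_measure
    by (simp add: weight_def cylinder_weight_def e_def)
  with * show "branch (Suc n) s \<in> sets \<mu>'"
    "emeasure \<mu>' (branch (Suc n) s) = ennreal (weight (Suc n) w)"
    by (simp_all add: branch_eq_image[OF w s e])
qed

lemma weight_nonneg: "weight n w \<ge> 0"
  by (simp add: weight_def cylinder_weight_def)

text \<open>
  The counting principle: it is applied both to all paths that end at \<open>w\<close> and to those of them
  whose last edge starts outside the subdiagram.
\<close>

lemma emeasure_branches:
  assumes w: "w \<in> W (Suc n)" and S: "S \<subseteq> paths_to B (Suc n) w"
  shows "(\<Union>s\<in>S. branch (Suc n) s) \<in> sets \<mu>'"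
    and "emeasure \<mu>' (\<Union>s\<in>S. branch (Suc n) s) = ennreal (card S * weight (Suc n) w)"
proof -
  have fin: "finite S"
    using finite_subset[OF S finite_paths_to] .
  have br: "branch (Suc n) s \<in> sets \<mu>'"
    "emeasure \<mu>' (branch (Suc n) s) = ennreal (weight (Suc n) w)" if "s \<in> S" for s
    using emeasure_branch[OF w] S that by blast+
  show "(\<Union>s\<in>S. branch (Suc n) s) \<in> sets \<mu>'"
    using fin br by blast
  have len: "length s = Suc n" if "s \<in> S" for s
    using S that by (auto simp: paths_to_def finite_paths_def)
  have "disjoint_family_on (branch (Suc n)) S"
    unfolding disjoint_family_on_def
  proof (intro ballI impI)
    fix s t assume st: "s \<in> S" "t \<in> S" "s \<noteq> t"
    then obtain k where "k < Suc n" "s ! k \<noteq> t ! k"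
      using len by (metis nth_equalityI)
    then show "branch (Suc n) s \<inter> branch (Suc n) t = {}"
      by (auto simp: branch_def)
  qed
  then have "emeasure \<mu>' (\<Union>s\<in>S. branch (Suc n) s) = (\<Sum>s\<in>S. emeasure \<mu>' (branch (Suc n) s))"
    using br fin by (intro sum_emeasure[symmetric]) auto
  also have "\<dots> = ennreal (card S * weight (Suc n) w)"
    using br(2) by (simp add: ennreal_mult weight_nonneg ennreal_of_nat_eq_real_of_nat)
  finally show "emeasure \<mu>' (\<Union>s\<in>S. branch (Suc n) s) = ennreal (card S * weight (Suc n) w)" .
qed

text \<open>
  The predicate \<open>P\<close> selects initial segments, so that one decomposition serves the whole tower over
  \<open>w\<close> as well as the part of it that has just come in from outside the subdiagram.
\<close>

lemma confined_paths_decompose: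
  "{x \<in> confined (Suc n). rng B (x n) = w \<and> P (map x [0..<Suc n])} =
     (\<Union>s\<in>{s \<in> paths_to B (Suc n) w. P s}. branch (Suc n) s)" (is "?L = ?R")
proof
  show "?L \<subseteq> ?R"
  proof clarify
    fix x assume x: "x \<in> confined (Suc n)" "w = rng B (x n)" "P (map x [0..<Suc n])"
    let ?s = "map x [0..<Suc n]"
    have nth: "?s ! k = x k" if "k < Suc n" for k
      using that by (simp del: upt_Suc)
    have "?s \<in> paths_to B (Suc n) (rng B (x n))"
      unfolding paths_to_Suc_iff
      using x(1) saturation_subset finite_path_of_infinite[of x B "Suc n"] nth[of n]
      by (auto simp: confined_def simp del: upt_Suc)
    moreover have "x \<in> branch (Suc n) ?s"
      using x(1) nth by (auto simp: branch_def simp del: upt_Suc)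
    ultimately show "x \<in> (\<Union>s\<in>{s \<in> paths_to B (Suc n) (rng B (x n)). P s}. branch (Suc n) s)"
      using x(3) by blast
  qed
  show "?R \<subseteq> ?L"
  proof clarify
    fix s x assume s: "s \<in> paths_to B (Suc n) w" "P s" and x: "x \<in> branch (Suc n) s"
    have len: "length s = Suc n"
      using s by (simp add: paths_to_def finite_paths_def)
    have "map x [0..<Suc n] = s"
      using x len by (intro nth_equalityI) (auto simp: branch_def simp del: upt_Suc)
    with s x show "x \<in> confined (Suc n) \<and> rng B (x n) = w \<and> P (map x [0..<Suc n])"
      by (auto simp: branch_def paths_to_Suc_iff)
  qed
qed

lemma emeasure_tower_part:
  assumes "w \<in> W (Suc n)"
  shows "tower_part B W (Suc n) w \<in> sets \<mu>'"
    and "emeasure \<mu>' (tower_part B W (Suc n) w) = ennreal (height B (Suc n) w * weight (Suc n) w)"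
proof -
  have "tower_part B W (Suc n) w = {x \<in> confined (Suc n). rng B (x n) = w \<and> True}"
    by (auto simp: tower_part_def confined_def)
  then have *: "tower_part B W (Suc n) w = (\<Union>s\<in>paths_to B (Suc n) w. branch (Suc n) s)"
    using confined_paths_decompose[of n w "\<lambda>_. True"] by simp
  show "tower_part B W (Suc n) w \<in> sets \<mu>'"
    "emeasure \<mu>' (tower_part B W (Suc n) w) = ennreal (height B (Suc n) w * weight (Suc n) w)"
    unfolding * using emeasure_branches[OF assms subset_refl] by (simp_all add: height_def)
qed

definition mass :: "nat \<Rightarrow> real" where
  "mass n = (\<Sum>w\<in>W n. real (height B n w) * weight n w)"

lemma confined_UN: "confined (Suc n) = (\<Union>w\<in>W (Suc n). tower_part B W (Suc n) w)"
  by (auto simp: tower_part_def confined_def)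

lemma confined_measurable: "confined (Suc n) \<in> sets \<mu>'"
  unfolding confined_UN using finite_W emeasure_tower_part(1) by blast

lemma emeasure_confined: "emeasure \<mu>' (confined (Suc n)) = ennreal (mass (Suc n))"
proof -
  have "emeasure \<mu>' (confined (Suc n)) = (\<Sum>w\<in>W (Suc n). emeasure \<mu>' (tower_part B W (Suc n) w))"
    unfolding confined_UN using finite_W emeasure_tower_part(1)
    by (intro sum_emeasure[symmetric]) (auto simp: disjoint_family_on_def tower_part_def)
  also have "\<dots> = (\<Sum>w\<in>W (Suc n). ennreal (height B (Suc n) w * weight (Suc n) w))"
    by (intro sum.cong refl emeasure_tower_part(2))
  also have "\<dots> = ennreal (mass (Suc n))"
    unfolding mass_def by (intro sum_ennreal) (simp add: weight_nonneg)
  finally show ?thesis .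
qed

text \<open>
  The paths counted here join the confined ones between levels \<open>n + 1\<close> and \<open>n + 2\<close>, through \<open>w\<close>.
  Their initial segments number \<open>\<Sum>v. f\<^bsub>wv\<^esub> h\<^sub>v\<close> over \<open>v\<close> outside the subdiagram, and this is \<open>h\<^sub>w\<close>
  times a sum of stochastic entries, since \<open>h\<^sub>w\<close> is not zero.
\<close>

lemma emeasure_newcomers:
  assumes w: "w \<in> W (Suc (Suc n))"
  shows "{x \<in> confined (Suc (Suc n)). rng B (x (Suc n)) = w \<and> rng B (x n) \<notin> W (Suc n)} \<in> sets \<mu>'"
    and "emeasure \<mu>' {x \<in> confined (Suc (Suc n)). rng B (x (Suc n)) = w \<and> rng B (x n) \<notin> W (Suc n)} =
      emeasure \<mu>' (tower_part B W (Suc (Suc n)) w) *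
        ennreal (\<Sum>v\<in>verts B (Suc n) - W (Suc n). stoch B (Suc n) w v)"
proof -
  let ?N = "{x \<in> confined (Suc (Suc n)). rng B (x (Suc n)) = w \<and> rng B (x n) \<notin> W (Suc n)}"
  let ?S = "{s \<in> paths_to B (Suc (Suc n)) w. rng B (s ! n) \<notin> W (Suc n)}"
  let ?V = "verts B (Suc n) - W (Suc n)"
  have "map x [0..<Suc (Suc n)] ! n = x n" for x :: "nat \<Rightarrow> 'e"
    by (simp add: nth_append)
  then have N: "?N = (\<Union>s\<in>?S. branch (Suc (Suc n)) s)"
    using confined_paths_decompose[of "Suc n" w "\<lambda>s. rng B (s ! n) \<notin> W (Suc n)"] by simp
  have S: "?S \<subseteq> paths_to B (Suc (Suc n)) w" by auto
  show "?N \<in> sets \<mu>'"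
    unfolding N by (rule emeasure_branches(1)[OF w S])
  have "?S = (\<Union>v\<in>?V. {s \<in> paths_to B (Suc (Suc n)) w. rng B (s ! n) = v})"
    using edge_ends(1)[of _ "Suc n"] by (auto simp: paths_to_def finite_paths_def)
  also have "card \<dots> = (\<Sum>v\<in>?V. card {s \<in> paths_to B (Suc (Suc n)) w. rng B (s ! n) = v})"
    using finite_verts finite_paths_to by (intro card_UN_disjoint) auto
  finally have card: "card ?S = (\<Sum>v\<in>?V. incidence B (Suc n) w v * height B (Suc n) v)"
    by (simp add: card_paths_through)
  have h: "height B (Suc (Suc n)) w > 0"
    using height_pos w W_subset by blast
  have "emeasure \<mu>' ?N = ennreal (card ?S * weight (Suc (Suc n)) w)"
    unfolding N by (rule emeasure_branches(2)[OF w S])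
  also have "card ?S * weight (Suc (Suc n)) w =
      (height B (Suc (Suc n)) w * weight (Suc (Suc n)) w) * (\<Sum>v\<in>?V. stoch B (Suc n) w v)"
    using h by (simp add: card stoch_def sum_divide_distrib[symmetric])
  also have "ennreal \<dots> = emeasure \<mu>' (tower_part B W (Suc (Suc n)) w) *
        ennreal (\<Sum>v\<in>?V. stoch B (Suc n) w v)"
    using w by (simp add: emeasure_tower_part(2) ennreal_mult weight_nonneg sum_nonneg stoch_def)
  finally show "emeasure \<mu>' ?N = emeasure \<mu>' (tower_part B W (Suc (Suc n)) w) *
        ennreal (\<Sum>v\<in>?V. stoch B (Suc n) w v)" .
qed

lemma confined_mono: "m \<le> n \<Longrightarrow> confined m \<subseteq> confined n"
  by (auto simp: confined_def)

text \<open>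
  The increments of the mass are the terms of the series in the stochastic matrices: a path that
  joins the confined ones at level \<open>n + 2\<close> is a newcomer at exactly one vertex.
\<close>

lemma mass_increment:
  "ennreal (mass (Suc (Suc n)) - mass (Suc n)) =
     (\<Sum>w\<in>W (Suc (Suc n)). emeasure \<mu>' (tower_part B W (Suc (Suc n)) w) *
        ennreal (\<Sum>v\<in>verts B (Suc n) - W (Suc n). stoch B (Suc n) w v))"
proof -
  let ?N = "\<lambda>w. {x \<in> confined (Suc (Suc n)). rng B (x (Suc n)) = w \<and> rng B (x n) \<notin> W (Suc n)}"
  have "confined (Suc (Suc n)) - confined (Suc n) = (\<Union>w\<in>W (Suc (Suc n)). ?N w)"
  proof (intro equalityI subsetI)
    fix x assume x: "x \<in> confined (Suc (Suc n)) - confined (Suc n)"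
    then obtain i where i: "i \<ge> Suc n" "rng B (x (i - 1)) \<notin> W i"
      by (auto simp: confined_def)
    \<comment> \<open>The only level at which the second set demands more than the first is \<open>n + 1\<close>.\<close>
    with x have "i = Suc n"
      by (auto simp: confined_def dest: le_neq_implies_less)
    with i x show "x \<in> (\<Union>w\<in>W (Suc (Suc n)). ?N w)"
      by (auto simp: confined_def)
  qed (auto simp: confined_def)
  then have "(\<Sum>w\<in>W (Suc (Suc n)). emeasure \<mu>' (?N w)) =
      emeasure \<mu>' (confined (Suc (Suc n)) - confined (Suc n))"
    using finite_W emeasure_newcomers(1)
    by (subst sum_emeasure) (auto simp: disjoint_family_on_def)
  also have "\<dots> = ennreal (mass (Suc (Suc n)) - mass (Suc n))"
    by (subst emeasure_Diff)
      (simp_all add: confined_measurable confined_mono emeasure_confined ennreal_minus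
        mass_def sum_nonneg weight_nonneg)
  finally show ?thesis
    by (simp add: emeasure_newcomers(2))
qed

lemma mass_mono: "mass (Suc n) \<le> mass (Suc (Suc n))"
proof -
  have "ennreal (mass (Suc n)) \<le> ennreal (mass (Suc (Suc n)))"
    unfolding emeasure_confined[symmetric]
    by (intro emeasure_mono confined_mono confined_measurable) simp
  then show ?thesis
    by (simp add: mass_def sum_nonneg weight_nonneg)
qed

lemma saturation_eq_UN: "saturation B W = (\<Union>n. confined (Suc n))"
proof
  show "saturation B W \<subseteq> (\<Union>n. confined (Suc n))"
  proof
    fix x assume x: "x \<in> saturation B W"
    then obtain y N where y: "y \<in> path_space C" and N: "\<And>k. k \<ge> N \<Longrightarrow> x k = y k"
      by (auto simp: saturation_def tail_equivalent_def)
    have "rng B (x (i - 1)) \<in> W i" if "i \<ge> Suc N" for i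
    proof -
      from that obtain j where j: "i = Suc j" "j \<ge> N"
        by (cases i) auto
      have "y j \<in> edges C (Suc j)"
        using y by (auto simp: path_space_def)
      then have "rng B (y j) \<in> W (Suc j)"
        by (simp only: subdiagram_edge_iff)
      with j N show ?thesis by simp
    qed
    with x show "x \<in> (\<Union>n. confined (Suc n))"
      by (auto simp: confined_def)
  qed
qed (auto simp: confined_def)

text \<open>
  Continuity from below, with the masses written as telescoping sums, so that the value is a
  series whether or not it is finite.
\<close>

lemma emeasure_saturation:
  "emeasure \<mu>' (saturation B W) =
     ennreal (mass (Suc 0)) + (\<Sum>n. ennreal (mass (Suc (Suc n)) - mass (Suc n)))"
proof -
  have "emeasure \<mu>' (saturation B W) = (SUP n. ennreal (mass (Suc n)))"
    unfolding saturation_eq_UN emeasure_confined[symmetric]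
    by (intro SUP_emeasure_incseq[symmetric])
      (simp_all add: image_subset_iff confined_measurable incseq_def confined_mono)
  also have "\<dots> = (SUP n. ennreal (mass (Suc 0)) +
      (\<Sum>k<n. ennreal (mass (Suc (Suc k)) - mass (Suc k))))"
  proof (rule SUP_cong[OF refl])
    fix n
    have "mass (Suc n) = mass (Suc 0) + (\<Sum>k<n. mass (Suc (Suc k)) - mass (Suc k))"
      by (simp add: sum_lessThan_telescope[of "\<lambda>k. mass (Suc k)"])
    moreover have "mass (Suc 0) \<ge> 0"
      by (simp add: mass_def sum_nonneg weight_nonneg)
    ultimately show "ennreal (mass (Suc n)) = ennreal (mass (Suc 0)) +
        (\<Sum>k<n. ennreal (mass (Suc (Suc k)) - mass (Suc k)))"
      using mass_mono by (simp add: sum_nonneg)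
  qed
  also have "\<dots> = ennreal (mass (Suc 0)) + (\<Sum>n. ennreal (mass (Suc (Suc n)) - mass (Suc n)))"
    by (simp add: ennreal_SUP_add_right suminf_eq_SUP)
  finally show ?thesis .
qed

end

section \<open>Finiteness of the extension\<close>

theorem theorem2p3:
  fixes B :: "('v, 'e) diagram"
    and W :: "nat \<Rightarrow> 'v set"
    and \<mu> \<mu>' :: "(nat \<Rightarrow> 'e) measure"
  defines "C \<equiv> vertex_subdiagram B W"
    and "h \<equiv> \<lambda>n v. real (height B n v)"
    and "p \<equiv> cylinder_weight (vertex_subdiagram B W) \<mu>"
  assumes "bratteli_diagram B"
    and "is_cantor_set (path_topology B)"
    and "proper_vertex_subdiagram B W"
    and "sets \<mu> = sets (borel_of (path_topology C))"
    and "prob_space \<mu>"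
    and "tail_invariant C \<mu>"
    and "is_extension B W \<mu> \<mu>'"
  shows "(emeasure \<mu>' (saturation B W) < \<infinity> \<longleftrightarrow>
           (\<Sum>n. \<Sum>w\<in>W (Suc (Suc n)). emeasure \<mu>' (tower_part B W (Suc (Suc n)) w) *
              ennreal (\<Sum>v\<in>verts B (Suc n) - W (Suc n). stoch B (Suc n) w v)) < \<infinity>) \<and>
         ((\<Sum>n. \<Sum>w\<in>W (Suc (Suc n)). emeasure \<mu>' (tower_part B W (Suc (Suc n)) w) *
              ennreal (\<Sum>v\<in>verts B (Suc n) - W (Suc n). stoch B (Suc n) w v)) < \<infinity> \<longleftrightarrow>
           summable (\<lambda>i. (\<Sum>w\<in>W (Suc (Suc i)). h (Suc (Suc i)) w * p (Suc (Suc i)) w) -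
              (\<Sum>w\<in>W (Suc i). h (Suc i) w * p (Suc i) w)))"
proof -
  interpret X: measure_extension B W \<mu> \<mu>'
    unfolding measure_extension_def measure_extension_axioms_def
    using assms(4,6,8,10) assms(7)[unfolded C_def] by blast
  let ?d = "\<lambda>n. X.mass (Suc (Suc n)) - X.mass (Suc n)"
  have mass: "(\<Sum>w\<in>W n. h n w * p n w) = X.mass n" for n
    by (simp add: X.mass_def X.weight_def h_def p_def)
  have nonneg: "?d n \<ge> 0" for n
    using X.mass_mono[of n] by simp
  have "(\<Sum>n. ennreal (?d n)) < \<infinity> \<longleftrightarrow> summable ?d"
    unfolding infinity_ennreal_def less_top[symmetric]
    using summable_suminf_not_top[of ?d, OF nonneg] ennreal_suminf_neq_top[of ?d, OF _ nonneg]
    by (rule_tac iffI)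
  moreover have "emeasure \<mu>' (saturation B W) < \<infinity> \<longleftrightarrow> (\<Sum>n. ennreal (?d n)) < \<infinity>"
    by (simp add: X.emeasure_saturation)
  ultimately show ?thesis
    unfolding mass X.mass_increment[symmetric] by blast
qed

end
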